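(* Let $0\le\eta_0,\eta_1\le1$ with $\eta_0+\eta_1>0$ be the efficiencies of Bob's two detectors, and let $\rho_{AB}$ be a two-qubit state that is symmetric in the $Z$ and $X$ bases, i.e. $\langle00|\rho_{AB}|00\rangle=\langle11|\rho_{AB}|11\rangle$, $\langle01|\rho_{AB}|01\rangle=\langle10|\rho_{AB}|10\rangle$, $\langle{++}|\rho_{AB}|{++}\rangle=\langle{--}|\rho_{AB}|{--}\rangle$ and $\langle{+-}|\rho_{AB}|{+-}\rangle=\langle{-+}|\rho_{AB}|{-+}\rangle$. Let $\rho_{AB}^Z,\rho_{AB}^X$ be the filtered states defined in the context, $e_b=\mathrm{Tr}(\Pi^-\rho_{AB}^Z)$ the observed bit error rate, $e_p=\mathrm{Tr}(\Pi_x^-\rho_{AB}^X)$ the observed phase error rate, and let $K$ be the BB84 key rate with detection efficiency mismatch, as defined in the context. Then $$K=H(x)-H(f(x,e_p))-H(e_b),$$ where $$x=\frac{\eta_0}{\eta_0+\eta_1},\qquad f(x,e_p)=\frac12+\sqrt{\left(\tfrac12-x\right)^2+x(1-x)(1-2e_p)^2}.$$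
   Context: Logarithms are base 2; $S(\rho)=-\mathrm{Tr}[\rho\log_2\rho]$; $H(e)=-e\log_2e-(1-e)\log_2(1-e)$. $|\pm\rangle=(|0\rangle\pm|1\rangle)/\sqrt2$, $\Pi^-=|01\rangle\langle01|+|10\rangle\langle10|$, $\Pi_x^-=|{+-}\rangle\langle{+-}|+|{-+}\rangle\langle{-+}|$. $C(\rho)=S(\rho^{\mathrm{diag}})-S(\rho)$ is the relative entropy of coherence in the reference basis $\{|00\rangle,|01\rangle,|10\rangle,|11\rangle\}$, with $\rho^{\mathrm{diag}}$ the diagonal part of $\rho$ in that basis. Detector model. Bob's inefficient measurements are modelled as filters followed by ideal measurements: $F_z=\sqrt{\eta_0}|0\rangle_B\langle0|+\sqrt{\eta_1}|1\rangle_B\langle1|$ for the $Z$ basis and $F_x=\sqrt{\eta_0}|+\rangle_B\langle+|+\sqrt{\eta_1}|-\rangle_B\langle-|$ for the $X$ basis, acting on Bob's qubit. The states before the ideal measurements are $\rho_{AB}^Z=F_z\rho_{AB}F_z/\mathrm{Tr}(F_z\rho_{AB}F_z)$ and $\rho_{AB}^X=F_x\rho_{AB}F_x/\mathrm{Tr}(F_x\rho_{AB}F_x)$. Key rate. The key is generated from the $Z$-basis bits of $\rho_{AB}^Z$. Let $\hat m_{00},\hat m_{11},\hat m_{22},\hat m_{33}$ be the diagonal elements of $\rho_{AB}^Z$ in the ordered basis $|00\rangle,|01\rangle,|10\rangle,|11\rangle$ and $e_p'=\mathrm{Tr}(\Pi_x^-\rho_{AB}^Z)$ its phase error rate. The key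 rate is $K=\min_{a,b}C(\rho(a,b))-H(e_b)$, where the minimum is over $a,b\in\mathbb{R}$ with $a+b=\tfrac12-e_p'$, $|a|\le\sqrt{\hat m_{00}\hat m_{33}}$, $|b|\le\sqrt{\hat m_{11}\hat m_{22}}$, and $$\rho(a,b)=\begin{pmatrix}\hat m_{00}&0&0&a\\ 0&\hat m_{11}&b&0\\ 0&b&\hat m_{22}&0\\ a&0&0&\hat m_{33}\end{pmatrix}.$$ *)

theory Defs
  imports "HOL-Analysis.Analysis"
begin

definition dagger :: "complex^'n^'m \<Rightarrow> complex^'m^'n" where
  "dagger A = (\<chi> i j. cnj (A $ j $ i))"

definition unitary_matrix :: "complex^'n^'n \<Rightarrow> bool" where
  "unitary_matrix U \<longleftrightarrow> dagger U ** U = mat 1 \<and> U ** dagger U = mat 1"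

definition diag_matrix :: "real^'n \<Rightarrow> complex^'n^'n" where
  "diag_matrix d = (\<chi> i j. if i = j then complex_of_real (d $ i) else 0)"

definition ketbra :: "complex^'n \<Rightarrow> complex^'n \<Rightarrow> complex^'n^'n" where
  "ketbra u v = (\<chi> i j. u $ i * cnj (v $ j))"

text \<open>\<open>expectation A v\<close> is \<open>\<langle>v|A|v\<rangle>\<close>.\<close>

definition expectation :: "complex^'n^'n \<Rightarrow> complex^'n \<Rightarrow> complex" where
  "expectation A v = (\<Sum>i\<in>UNIV. cnj (v $ i) * (A *v v) $ i)"

definition density_matrix :: "complex^'n^'n \<Rightarrow> bool" where
  "density_matrix \<rho> \<longleftrightarrow>
     dagger \<rho> = \<rho> \<and> (\<forall>v. 0 \<le> Re (expectation \<rho> v)) \<and> trace \<rho> = 1"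

text \<open>
  Functional calculus for Hermitian matrices. The result does not depend on the
  unitary diagonalisation; it is unspecified for matrices without one.
\<close>

definition spectral_fun :: "(real \<Rightarrow> real) \<Rightarrow> complex^'n^'n \<Rightarrow> complex^'n^'n" where
  "spectral_fun g A =
     (THE B. \<exists>U d. unitary_matrix U \<and> A = U ** diag_matrix d ** dagger U \<and>
                   B = U ** diag_matrix (\<chi> i. g (d $ i)) ** dagger U)"

text \<open>
  As \<open>log 2 0\<close> is a real number, the convention \<open>0 log 0 = 0\<close> holds in
  both entropies; for a singular matrix, the value given to the logarithm on the kernel
  is cancelled by the factor \<open>\<rho>\<close>.
\<close>

definition binary_entropy :: "real \<Rightarrow> real" where
  "binary_entropy e = - e * log 2 e - (1 - e) * log 2 (1 - e)"

definition von_neumann_entropy :: "complex^'n^'n \<Rightarrow> real" where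
  "von_neumann_entropy \<rho> = - Re (trace (\<rho> ** spectral_fun (log 2) \<rho>))"

definition diagonal_part :: "complex^'n^'n \<Rightarrow> complex^'n^'n" where
  "diagonal_part \<rho> = (\<chi> i j. if i = j then \<rho> $ i $ j else 0)"

definition coherence :: "complex^'n^'n \<Rightarrow> real" where
  "coherence \<rho> = von_neumann_entropy (diagonal_part \<rho>) - von_neumann_entropy \<rho>"

text \<open>
  The index type \<open>2\<close> has the elements \<open>0\<close> and \<open>1\<close>, and the basis of the
  two-qubit space is indexed by pairs (Alice, Bob).
\<close>

type_synonym qubit = "complex^2"
type_synonym qubit_op = "complex^2^2"
type_synonym two_qubit = "complex^(2 \<times> 2)"
type_synonym two_qubit_op = "complex^(2 \<times> 2)^(2 \<times> 2)"

definition ket :: "2 \<Rightarrow> qubit" where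
  "ket i = axis i 1"

definition ket_plus :: qubit where
  "ket_plus = (1 / sqrt 2) *\<^sub>R (ket 0 + ket 1)"

definition ket_minus :: qubit where
  "ket_minus = (1 / sqrt 2) *\<^sub>R (ket 0 - ket 1)"

definition tensor_ket :: "qubit \<Rightarrow> qubit \<Rightarrow> two_qubit" where
  "tensor_ket u v = (\<chi> p. u $ fst p * v $ snd p)"

definition tensor_op :: "qubit_op \<Rightarrow> qubit_op \<Rightarrow> two_qubit_op" where
  "tensor_op A B = (\<chi> p q. A $ fst p $ fst q * B $ snd p $ snd q)"

definition ket2 :: "2 \<Rightarrow> 2 \<Rightarrow> two_qubit" where
  "ket2 i j = tensor_ket (ket i) (ket j)"

abbreviation proj :: "complex^'n \<Rightarrow> complex^'n^'n" where
  "proj v \<equiv> ketbra v v"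

definition Pi_z_minus :: two_qubit_op where
  "Pi_z_minus = proj (ket2 0 1) + proj (ket2 1 0)"

definition Pi_x_minus :: two_qubit_op where
  "Pi_x_minus =
     proj (tensor_ket ket_plus ket_minus) + proj (tensor_ket ket_minus ket_plus)"

definition symmetric_ZX :: "two_qubit_op \<Rightarrow> bool" where
  "symmetric_ZX \<rho> \<longleftrightarrow>
     expectation \<rho> (ket2 0 0) = expectation \<rho> (ket2 1 1) \<and>
     expectation \<rho> (ket2 0 1) = expectation \<rho> (ket2 1 0) \<and>
     expectation \<rho> (tensor_ket ket_plus ket_plus) =
       expectation \<rho> (tensor_ket ket_minus ket_minus) \<and>
     expectation \<rho> (tensor_ket ket_plus ket_minus) =
       expectation \<rho> (tensor_ket ket_minus ket_plus)"

definition F_z :: "real \<Rightarrow> real \<Rightarrow> qubit_op" where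
  "F_z \<eta>0 \<eta>1 = sqrt \<eta>0 *\<^sub>R proj (ket 0) + sqrt \<eta>1 *\<^sub>R proj (ket 1)"

definition F_x :: "real \<Rightarrow> real \<Rightarrow> qubit_op" where
  "F_x \<eta>0 \<eta>1 = sqrt \<eta>0 *\<^sub>R proj ket_plus + sqrt \<eta>1 *\<^sub>R proj ket_minus"

definition filter_Bob :: "qubit_op \<Rightarrow> two_qubit_op \<Rightarrow> two_qubit_op" where
  "filter_Bob F \<rho> =
     (let \<sigma> = tensor_op (mat 1) F ** \<rho> ** tensor_op (mat 1) F
      in \<sigma> /\<^sub>R Re (trace \<sigma>))"

definition rho_Z :: "real \<Rightarrow> real \<Rightarrow> two_qubit_op \<Rightarrow> two_qubit_op" where
  "rho_Z \<eta>0 \<eta>1 \<rho> = filter_Bob (F_z \<eta>0 \<eta>1) \<rho>"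

definition rho_X :: "real \<Rightarrow> real \<Rightarrow> two_qubit_op \<Rightarrow> two_qubit_op" where
  "rho_X \<eta>0 \<eta>1 \<rho> = filter_Bob (F_x \<eta>0 \<eta>1) \<rho>"

definition bit_error :: "two_qubit_op \<Rightarrow> real" where
  "bit_error \<sigma> = Re (trace (Pi_z_minus ** \<sigma>))"

definition phase_error :: "two_qubit_op \<Rightarrow> real" where
  "phase_error \<sigma> = Re (trace (Pi_x_minus ** \<sigma>))"

text \<open>In the definitions that lead up to \<open>key_rate\<close>, \<open>\<sigma>\<close> stands for the filtered state \<open>rho_Z \<eta>0 \<eta>1 \<rho>\<close>.\<close>

definition diag_elem :: "two_qubit_op \<Rightarrow> 2 \<Rightarrow> 2 \<Rightarrow> real" where
  "diag_elem \<sigma> i j = Re (\<sigma> $ (i, j) $ (i, j))"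

definition rho_ab :: "two_qubit_op \<Rightarrow> real \<Rightarrow> real \<Rightarrow> two_qubit_op" where
  "rho_ab \<sigma> a b =
     diag_elem \<sigma> 0 0 *\<^sub>R proj (ket2 0 0) + diag_elem \<sigma> 0 1 *\<^sub>R proj (ket2 0 1) +
     diag_elem \<sigma> 1 0 *\<^sub>R proj (ket2 1 0) + diag_elem \<sigma> 1 1 *\<^sub>R proj (ket2 1 1) +
     a *\<^sub>R (ketbra (ket2 0 0) (ket2 1 1) + ketbra (ket2 1 1) (ket2 0 0)) +
     b *\<^sub>R (ketbra (ket2 0 1) (ket2 1 0) + ketbra (ket2 1 0) (ket2 0 1))"

definition feasible :: "two_qubit_op \<Rightarrow> real \<times> real \<Rightarrow> bool" where
  "feasible \<sigma> = (\<lambda>(a, b).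
     a + b = 1 / 2 - phase_error \<sigma> \<and>
     \<bar>a\<bar> \<le> sqrt (diag_elem \<sigma> 0 0 * diag_elem \<sigma> 1 1) \<and>
     \<bar>b\<bar> \<le> sqrt (diag_elem \<sigma> 0 1 * diag_elem \<sigma> 1 0))"

definition coherence_ab :: "two_qubit_op \<Rightarrow> real \<times> real \<Rightarrow> real" where
  "coherence_ab \<sigma> = (\<lambda>(a, b). coherence (rho_ab \<sigma> a b))"

definition key_rate :: "two_qubit_op \<Rightarrow> real" where
  "key_rate \<sigma> =
     (LEAST c. \<exists>p. feasible \<sigma> p \<and> c = coherence_ab \<sigma> p) - binary_entropy (bit_error \<sigma>)"

definition f_mismatch :: "real \<Rightarrow> real \<Rightarrow> real" where
  "f_mismatch x e = 1 / 2 + sqrt ((1 / 2 - x)\<^sup>2 + x * (1 - x) * (1 - 2 * e)\<^sup>2)"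

end

(* By symmetry, the diagonal of the filtered state is the product of the distributions
   (x, 1 - x) and (1 - e_b, e_b), and a + b = sqrt (x (1 - x)) (1 - 2 e_p). Both 2 x 2 blocks of
   rho(a,b) are diagonalised by rotations; half the spectral gap of a block is the Euclidean norm of
   (half the diagonal difference, off-diagonal entry). The entropy of rho(a,b) is therefore H(e_b) plus
   the (1 - e_b, e_b)-average of two values of H. By the triangle inequality for the norms, Gibbs'
   inequality and the monotonicity of H on [1/2, 1], the average is at most H(f(x, e_p)), and equality
   holds when a : b = (1 - e_b) : e_b. *)

theory Submission
  imports Defs
begin

section \<open>Functional calculus and entropy\<close>

lemma dagger_diag_unitary:
  fixes U :: "complex^'n^'n"
  assumes "unitary_matrix U"
  shows "dagger U ** (U ** B) = B" "(B ** dagger U) ** U = B"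
    "U ** (dagger U ** B) = B" "(B ** U) ** dagger U = B"
  using assms unfolding unitary_matrix_def
  by (metis matrix_mul_assoc matrix_mul_lid matrix_mul_rid)+

lemma diag_matrix_mult_left: "(diag_matrix d ** A) $ i $ j = complex_of_real (d $ i) * A $ i $ j"
  by (simp add: diag_matrix_def matrix_matrix_mult_def if_distrib[of "\<lambda>t. t * _"] cong: if_cong)

lemma diag_matrix_mult_right: "(A ** diag_matrix d) $ i $ j = A $ i $ j * complex_of_real (d $ j)"
  by (simp add: diag_matrix_def matrix_matrix_mult_def if_distrib[of "\<lambda>t. _ * t"] cong: if_cong)

text \<open>The matrix \<open>W = dagger V ** U\<close> intertwines the two diagonal matrices, so
  \<open>W $ i $ j\<close> can be nonzero only where \<open>d $ j = e $ i\<close>. It then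
  intertwines their images under \<open>g\<close> as well. This makes the description in
  \<open>spectral_fun\<close> unambiguous.\<close>

lemma spectral_fun_unique:
  fixes U V :: "complex^'n^'n"
  assumes "unitary_matrix U" "unitary_matrix V"
    and "U ** diag_matrix d ** dagger U = V ** diag_matrix e ** dagger V"
  shows "U ** diag_matrix (\<chi> i. g (d $ i)) ** dagger U = V ** diag_matrix (\<chi> i. g (e $ i)) ** dagger V"
proof -
  define W where "W = dagger V ** U"
  have "dagger V ** (U ** diag_matrix d ** dagger U) ** U =
        dagger V ** (V ** diag_matrix e ** dagger V) ** U"
    using assms(3) by simp
  then have "W ** diag_matrix d = diag_matrix e ** W"
    by (simp add: W_def matrix_mul_assoc[symmetric] dagger_diag_unitary[OF assms(1)]
        dagger_diag_unitary[OF assms(2)])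
       (metis assms(1) unitary_matrix_def matrix_mul_rid)
  then have "W $ i $ j * complex_of_real (d $ j) = complex_of_real (e $ i) * W $ i $ j" for i j
    by (metis diag_matrix_mult_left diag_matrix_mult_right)
  then have *: "W $ i $ j = 0 \<or> d $ j = e $ i" for i j
    by (metis mult.commute mult_cancel_left of_real_eq_iff)
  have "W ** diag_matrix (\<chi> i. g (d $ i)) = diag_matrix (\<chi> i. g (e $ i)) ** W"
    unfolding vec_eq_iff diag_matrix_mult_left diag_matrix_mult_right
    using * by (metis mult.commute mult_zero_left vec_lambda_beta)
  then have "V ** (W ** diag_matrix (\<chi> i. g (d $ i))) ** dagger U =
             V ** (diag_matrix (\<chi> i. g (e $ i)) ** W) ** dagger U"
    by simp
  moreover have "V ** (W ** X) = U ** X" for X :: "complex^'n^'n"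
    by (simp add: W_def matrix_mul_assoc[symmetric] dagger_diag_unitary[OF assms(2)])
  moreover have "V ** (X ** W) ** dagger U = V ** X ** dagger V" for X :: "complex^'n^'n"
    by (simp add: W_def matrix_mul_assoc dagger_diag_unitary[OF assms(1)])
  ultimately show ?thesis by simp
qed

lemma spectral_fun_diagonalised:
  assumes "unitary_matrix U"
  shows "spectral_fun g (U ** diag_matrix d ** dagger U) =
         U ** diag_matrix (\<chi> i. g (d $ i)) ** dagger U"
  unfolding spectral_fun_def
  by (rule the_equality) (use assms in \<open>auto intro: spectral_fun_unique\<close>)

text \<open>Cyclicity of the trace removes \<open>U\<close>, which leaves a product of two diagonal
  matrices.\<close>

lemma von_neumann_entropy_diagonalised:
  fixes U :: "complex^'n^'n"
  assumes "unitary_matrix U"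
  shows "von_neumann_entropy (U ** diag_matrix d ** dagger U) = (\<Sum>i\<in>UNIV. - d $ i * log 2 (d $ i))"
proof -
  let ?L = "diag_matrix (\<chi> i. log 2 (d $ i))"
  have "trace (U ** diag_matrix d ** dagger U ** (U ** ?L ** dagger U)) =
        trace (U ** (diag_matrix d ** ?L ** dagger U))"
    by (simp add: matrix_mul_assoc[symmetric] dagger_diag_unitary[OF assms])
  also have "\<dots> = trace (diag_matrix d ** ?L)"
    by (subst trace_mul_sym) (simp add: dagger_diag_unitary[OF assms])
  also have "\<dots> = (\<Sum>i\<in>UNIV. complex_of_real (d $ i * log 2 (d $ i)))"
    by (simp add: trace_def diag_matrix_mult_left) (simp add: diag_matrix_def)
  finally show ?thesis
    by (simp add: von_neumann_entropy_def spectral_fun_diagonalised[OF assms] sum_negf)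
qed

section \<open>Diagonalisation of \<open>rho_ab\<close>\<close>

lemma UNIV_two: "(UNIV :: 2 set) = {0, 1}"
  by (rule card_subset_eq[symmetric]) auto

lemma sum_two_qubit:
  "(\<Sum>p\<in>UNIV. g p) = g (0, 0) + g (0, 1) + g (1, 0) + g ((1, 1) :: 2 \<times> 2)"
  by (simp add: UNIV_Times_UNIV[symmetric] UNIV_two sum.cartesian_product[symmetric] add.assoc
      del: UNIV_Times_UNIV)

lemma all_two_qubit:
  "(\<forall>p. P p) \<longleftrightarrow> P (0, 0) \<and> P (0, 1) \<and> P (1, 0) \<and> P ((1, 1) :: 2 \<times> 2)"
proof -
  have "(\<forall>p\<in>UNIV. P p) \<longleftrightarrow> P (0, 0) \<and> P (0, 1) \<and> P (1, 0) \<and> P ((1, 1) :: 2 \<times> 2)"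
    by (simp only: UNIV_Times_UNIV[symmetric] UNIV_two) auto
  then show ?thesis by simp
qed

lemma ket_component: "ket i $ j = (if i = j then 1 else 0)"
  by (simp add: ket_def axis_def)

lemma ket2_component: "ket2 i j $ p = (if p = (i, j) then 1 else 0)"
  by (cases p) (auto simp: ket2_def tensor_ket_def ket_component)

lemma rho_ab_component:
  "rho_ab \<sigma> a b $ p $ q = complex_of_real
     (if p = q then diag_elem \<sigma> (fst p) (snd p)
      else if p \<in> {(0, 0), (1, 1)} \<and> q \<in> {(0, 0), (1, 1)} then a
      else if p \<in> {(0, 1), (1, 0)} \<and> q \<in> {(0, 1), (1, 0)} then b else 0)"
proof -
  have "\<forall>p q. rho_ab \<sigma> a b $ p $ q = complex_of_real
     (if p = q then diag_elem \<sigma> (fst p) (snd p)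
      else if p \<in> {(0, 0), (1, 1)} \<and> q \<in> {(0, 0), (1, 1)} then a
      else if p \<in> {(0, 1), (1, 0)} \<and> q \<in> {(0, 1), (1, 0)} then b else 0)"
    unfolding all_two_qubit by (simp add: rho_ab_def ketbra_def ket2_component scaleR_conv_of_real[of _ "_ :: complex"])
  then show ?thesis by blast
qed

text \<open>The eigenvalues of the symmetric matrix with diagonal \<open>p\<close>, \<open>q\<close>
  and off-diagonal entry \<open>a\<close> are \<open>(p + q) / 2 + half_gap p q a\<close> and
  \<open>(p + q) / 2 - half_gap p q a\<close>.\<close>

definition half_gap :: "real \<Rightarrow> real \<Rightarrow> real \<Rightarrow> real" where
  "half_gap p q a = sqrt (((p - q) / 2)\<^sup>2 + a\<^sup>2)"

text \<open>Polar coordinates: the vector \<open>((p - q) / 2, a)\<close> has length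
  \<open>half_gap p q a\<close> and some angle \<theta>. The rotation by half of \<theta>
  diagonalises the matrix, and the last three equations list its entries.\<close>

lemma symmetric_2x2_rotation:
  obtains c s where "c\<^sup>2 + s\<^sup>2 = 1"
    "p = c\<^sup>2 * ((p + q) / 2 + half_gap p q a) + s\<^sup>2 * ((p + q) / 2 - half_gap p q a)"
    "q = s\<^sup>2 * ((p + q) / 2 + half_gap p q a) + c\<^sup>2 * ((p + q) / 2 - half_gap p q a)"
    "a = c * s * (((p + q) / 2 + half_gap p q a) - ((p + q) / 2 - half_gap p q a))"
proof -
  define T where "T = half_gap p q a"
  have T2: "T\<^sup>2 = ((p - q) / 2)\<^sup>2 + a\<^sup>2"
    by (simp add: T_def half_gap_def)
  have "\<exists>\<theta>. (p - q) / 2 = T * cos \<theta> \<and> a = T * sin \<theta>"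
  \<comment> \<open>If the gap vanishes, so do both coordinates, and any angle serves.\<close>
  proof (cases "T = 0")
    case True
    then show ?thesis using T2 by (simp add: sum_power2_eq_zero_iff)
  next
    case False
    then have "((p - q) / 2 / T)\<^sup>2 + (a / T)\<^sup>2 = 1"
      using T2 by (metis power_divide add_divide_distrib divide_self power_not_zero)
    then obtain \<theta> where "(p - q) / 2 / T = cos \<theta>" "a / T = sin \<theta>"
      using sincos_total_2pi by metis
    then show ?thesis using False by (intro exI[of _ \<theta>]) (simp add: field_simps)
  qed
  then obtain \<theta> where \<theta>: "(p - q) / 2 = T * cos \<theta>" "a = T * sin \<theta>" by blast
  \<comment> \<open>Conjugating a diagonal matrix by a rotation doubles the angle, hence the half
    angle.\<close>
  define c s where "c = cos (\<theta> / 2)" and "s = sin (\<theta> / 2)"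
  have cs: "c\<^sup>2 + s\<^sup>2 = 1" by (simp add: c_def s_def)
  have dbl: "cos \<theta> = c\<^sup>2 - s\<^sup>2" "sin \<theta> = 2 * s * c"
    using cos_double[of "\<theta> / 2"] sin_double[of "\<theta> / 2"] by (simp_all add: c_def s_def)
  define M where "M = (p + q) / 2"
  have mean: "c\<^sup>2 * M + s\<^sup>2 * M = M"
    using cs by (metis distrib_right mult_1)
  have diff: "(p - q) / 2 = T * c\<^sup>2 - T * s\<^sup>2"
    using \<theta>(1) dbl by (simp add: algebra_simps)
  have "p = M + (p - q) / 2" "q = M - (p - q) / 2"
    by (simp_all add: M_def field_simps)
  then have pq: "p = M + (T * c\<^sup>2 - T * s\<^sup>2)" "q = M - (T * c\<^sup>2 - T * s\<^sup>2)"
    unfolding diff .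
  show thesis
  proof (rule that[OF cs])
    show "p = c\<^sup>2 * ((p + q) / 2 + half_gap p q a) + s\<^sup>2 * ((p + q) / 2 - half_gap p q a)"
      unfolding T_def[symmetric] M_def[symmetric] using mean pq by (simp add: algebra_simps)
    show "q = s\<^sup>2 * ((p + q) / 2 + half_gap p q a) + c\<^sup>2 * ((p + q) / 2 - half_gap p q a)"
      unfolding T_def[symmetric] M_def[symmetric] using mean pq by (simp add: algebra_simps)
    show "a = c * s * (((p + q) / 2 + half_gap p q a) - ((p + q) / 2 - half_gap p q a))"
      unfolding T_def[symmetric] using \<theta>(2) dbl by (simp add: algebra_simps)
  qed
qed

definition entropy_term :: "real \<Rightarrow> real" where
  "entropy_term y = - y * log 2 y"

text \<open>The two eigenvalues enter without normalisation, since a block carries only part of the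
  trace.\<close>

definition block_entropy :: "real \<Rightarrow> real \<Rightarrow> real \<Rightarrow> real" where
  "block_entropy p q a =
     entropy_term ((p + q) / 2 + half_gap p q a) + entropy_term ((p + q) / 2 - half_gap p q a)"

text \<open>Without an off-diagonal entry the eigenvalues are \<open>p\<close> and \<open>q\<close>;
  the absolute value from \<open>half_gap\<close> only decides their order.\<close>

lemma block_entropy_diag: "block_entropy p q 0 = entropy_term p + entropy_term q"
proof -
  have h: "half_gap p q 0 = \<bar>(p - q) / 2\<bar>"
    by (simp add: half_gap_def)
  have "(p + q) / 2 + (p - q) / 2 = p" "(p + q) / 2 - (p - q) / 2 = q"
    by (simp_all add: field_simps)
  then show ?thesis
    unfolding block_entropy_def h by (cases "(p - q) / 2 \<ge> 0") (simp_all add: abs_if)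
qed

lemma block_entropy_commute: "block_entropy p q a = block_entropy q p a"
  by (simp add: block_entropy_def half_gap_def add.commute[of p q] power2_commute[of p q] power_divide)

text \<open>The second block is taken in the order 10, 01, so that the first entries of the two blocks
  both carry the factor \<open>x\<close> and the diagonal differences add up in \<open>half_gap_triangle\<close>.\<close>

lemma von_neumann_entropy_rho_ab:
  "von_neumann_entropy (rho_ab \<sigma> a b) =
     block_entropy (diag_elem \<sigma> 0 0) (diag_elem \<sigma> 1 1) a +
     block_entropy (diag_elem \<sigma> 1 0) (diag_elem \<sigma> 0 1) b"
proof -
  define p q r t where "p = diag_elem \<sigma> 0 0" and "q = diag_elem \<sigma> 1 1"
    and "r = diag_elem \<sigma> 0 1" and "t = diag_elem \<sigma> 1 0"
  define l1 l2 l3 l4 where "l1 = (p + q) / 2 + half_gap p q a" and "l2 = (p + q) / 2 - half_gap p q a"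
    and "l3 = (r + t) / 2 + half_gap r t b" and "l4 = (r + t) / 2 - half_gap r t b"
  obtain c s where cs: "c\<^sup>2 + s\<^sup>2 = 1" "p = c\<^sup>2 * l1 + s\<^sup>2 * l2" "q = s\<^sup>2 * l1 + c\<^sup>2 * l2"
      "a = c * s * (l1 - l2)"
    unfolding l1_def l2_def by (rule symmetric_2x2_rotation[of p q a])
  obtain c' s' where cs': "c'\<^sup>2 + s'\<^sup>2 = 1" "r = c'\<^sup>2 * l3 + s'\<^sup>2 * l4" "t = s'\<^sup>2 * l3 + c'\<^sup>2 * l4"
      "b = c' * s' * (l3 - l4)"
    unfolding l3_def l4_def by (rule symmetric_2x2_rotation[of r t b])
  have one: "complex_of_real c * complex_of_real c + complex_of_real s * complex_of_real s = 1"
    "complex_of_real c' * complex_of_real c' + complex_of_real s' * complex_of_real s' = 1"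
    using cs(1) cs'(1) by (metis of_real_1 of_real_add of_real_mult power2_eq_square)+
  \<comment> \<open>The columns of \<open>U\<close> are eigenvectors: one rotation acts in the plane
    of 00 and 11, the other in the plane of 01 and 10.\<close>
  define U :: two_qubit_op where
    "U = (\<chi> i j. if i = (0, 0) then if j = (0, 0) then of_real c else if j = (1, 1) then - of_real s else 0
       else if i = (1, 1) then if j = (0, 0) then of_real s else if j = (1, 1) then of_real c else 0
       else if i = (0, 1) then if j = (0, 1) then of_real c' else if j = (1, 0) then - of_real s' else 0
       else if j = (0, 1) then of_real s' else if j = (1, 0) then of_real c' else 0)"
  define d :: "real^(2 \<times> 2)" where
    "d = (\<chi> i. if i = (0, 0) then l1 else if i = (1, 1) then l2 else if i = (0, 1) then l3 else l4)"
  have U: "unitary_matrix U"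
    unfolding unitary_matrix_def vec_eq_iff all_two_qubit
    using one by (simp add: matrix_matrix_mult_def sum_two_qubit dagger_def U_def mat_def algebra_simps)
  have "rho_ab \<sigma> a b = U ** diag_matrix d ** dagger U"
    unfolding vec_eq_iff all_two_qubit
    \<comment> \<open>Only the outer product is expanded; the inner one, with a diagonal matrix,
      just scales columns.\<close>
    unfolding matrix_matrix_mult_def[of _ "dagger U"]
    by (simp add: diag_matrix_mult_right sum_two_qubit dagger_def U_def d_def
          rho_ab_component p_def[symmetric] q_def[symmetric] r_def[symmetric] t_def[symmetric])
       (simp add: cs(2-4) cs'(2-4) power2_eq_square algebra_simps)
  then have "von_neumann_entropy (rho_ab \<sigma> a b) = (\<Sum>i\<in>UNIV. - d $ i * log 2 (d $ i))"
    using von_neumann_entropy_diagonalised[OF U] by simp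
  also have "\<dots> = block_entropy p q a + block_entropy r t b"
    by (simp add: sum_two_qubit d_def block_entropy_def entropy_term_def l1_def l2_def l3_def l4_def algebra_simps)
  finally show ?thesis by (simp add: p_def q_def r_def t_def block_entropy_commute)
qed

text \<open>This puts the diagonal part into the same family, so that one entropy formula serves
  both terms of the coherence.\<close>

lemma diagonal_part_rho_ab: "diagonal_part (rho_ab \<sigma> a b) = rho_ab \<sigma> 0 0"
  unfolding vec_eq_iff by (simp add: diagonal_part_def rho_ab_component)

section \<open>Binary entropy\<close>

lemma binary_entropy_eq: "binary_entropy u = entropy_term u + entropy_term (1 - u)"
  by (simp add: binary_entropy_def entropy_term_def algebra_simps)

lemma entropy_term_mult:
  assumes "0 \<le> s" "0 \<le> u"
  shows "entropy_term (s * u) = s * entropy_term u + u * entropy_term s"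
  using assms by (cases "s = 0 \<or> u = 0") (auto simp: entropy_term_def log_mult algebra_simps)

text \<open>Grouping rule: splitting a weight \<open>s\<close> in the ratio \<open>u\<close> to
  \<open>1 - u\<close> adds the entropy of the split, weighted by \<open>s\<close>, to the term for
  \<open>s\<close> itself.\<close>

lemma entropy_term_split:
  assumes "0 \<le> s" "0 \<le> u" "u \<le> 1"
  shows "entropy_term (s * u) + entropy_term (s * (1 - u)) = s * binary_entropy u + entropy_term s"
  using assms entropy_term_mult[of s u] entropy_term_mult[of s "1 - u"]
  by (simp add: binary_entropy_eq algebra_simps)

text \<open>The right-hand side is the tangent at \<open>z\<close> to the concave
  \<open>entropy_term\<close>. The bound is \<open>ln t \<le> t - 1\<close> at
  \<open>t = z / y\<close>.\<close>

lemma entropy_term_le_tangent: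
  assumes "0 \<le> y" "0 < z"
  shows "entropy_term y \<le> - y * log 2 z + (z - y) / ln 2"
proof (cases "y = 0")
  case True
  then show ?thesis using assms by (simp add: entropy_term_def)
next
  case False
  then have y: "0 < y" using assms by simp
  have "ln (z / y) \<le> z / y - 1" using assms y by (intro ln_le_minus_one) simp
  then have "y * (ln z - ln y) \<le> y * (z / y - 1)" using assms y by (simp add: ln_div)
  also have "\<dots> = z - y" using y by (simp add: field_simps)
  finally have "- y * ln y \<le> - y * ln z + (z - y)" by (simp add: algebra_simps)
  then have "- y * ln y / ln 2 \<le> (- y * ln z + (z - y)) / ln 2"
    by (intro divide_right_mono) auto
  then show ?thesis by (simp add: entropy_term_def log_def add_divide_distrib diff_divide_distrib)
qed

text \<open>Gibbs' inequality: when the tangents at \<open>q\<close> and \<open>1 - q\<close> are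
  added, the correction terms cancel.\<close>

lemma binary_entropy_le_cross_entropy:
  assumes "0 \<le> p" "p \<le> 1" "0 < q" "q < 1"
  shows "binary_entropy p \<le> - p * log 2 q - (1 - p) * log 2 (1 - q)"
proof -
  have "entropy_term p + entropy_term (1 - p) \<le>
      (- p * log 2 q + (q - p) / ln 2) + (- (1 - p) * log 2 (1 - q) + ((1 - q) - (1 - p)) / ln 2)"
    using assms by (intro add_mono entropy_term_le_tangent) auto
  also have "\<dots> = - p * log 2 q - (1 - p) * log 2 (1 - q)"
    by (simp add: diff_divide_distrib algebra_simps)
  finally show ?thesis by (simp add: binary_entropy_eq)
qed

text \<open>Gibbs' inequality with the common reference \<open>q\<close> bounds both entropies by
  functions affine in \<open>p\<close> and \<open>p'\<close>. Their average is
  \<open>binary_entropy q\<close> minus \<open>(m - q) * (log 2 q - log 2 (1 - q))\<close>, where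
  \<open>m\<close> is the mean of \<open>p\<close> and \<open>p'\<close>; this product is
  nonnegative because \<open>m \<ge> q\<close> and \<open>q \<ge> 1 / 2\<close>. Concavity and
  monotonicity are thus handled in one step.\<close>

lemma binary_entropy_mixture_le:
  assumes u: "0 \<le> u" "u \<le> 1" and p: "0 \<le> p" "p \<le> 1" and p': "0 \<le> p'" "p' \<le> 1"
    and q: "1 / 2 \<le> q" "q \<le> 1" "q \<le> (1 - u) * p + u * p'"
  shows "(1 - u) * binary_entropy p + u * binary_entropy p' \<le> binary_entropy q"
proof (cases "q = 1")
  case True
  \<comment> \<open>The reference \<open>q = 1\<close> lies outside Gibbs' inequality. Here the mean
    must be 1, so each term has weight zero or entropy zero.\<close>
  have "(1 - u) * (1 - p) + u * (1 - p') \<le> 0"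
    using q True by (simp add: algebra_simps)
  moreover have "0 \<le> (1 - u) * (1 - p)" "0 \<le> u * (1 - p')" using u p p' by auto
  ultimately have "(1 - u) * (1 - p) = 0" "u * (1 - p') = 0" by linarith+
  then show ?thesis using True by (auto simp: binary_entropy_def)
next
  case False
  then have q1: "0 < q" "q < 1" using q by auto
  define m where "m = (1 - u) * p + u * p'"
  have "(1 - u) * binary_entropy p + u * binary_entropy p' \<le>
      (1 - u) * (- p * log 2 q - (1 - p) * log 2 (1 - q)) +
      u * (- p' * log 2 q - (1 - p') * log 2 (1 - q))"
    using u p p' q1 by (intro add_mono mult_left_mono binary_entropy_le_cross_entropy) auto
  also have "\<dots> = binary_entropy q - (m - q) * (log 2 q - log 2 (1 - q))"
    by (simp add: m_def binary_entropy_def algebra_simps)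
  also have "\<dots> \<le> binary_entropy q"
  proof -
    have "log 2 (1 - q) \<le> log 2 q" using q q1 by simp
    then show ?thesis using q(3) by (simp add: m_def)
  qed
  finally show ?thesis .
qed

section \<open>Maximising the entropy\<close>

text \<open>\<open>s\<close> is the trace of the block and \<open>t\<close> its half gap relative to
  the trace. The eigenvalues are then \<open>s * (1 / 2 + t)\<close> and
  \<open>s * (1 / 2 - t)\<close>, and the grouping rule applies.\<close>

lemma block_entropy_scaled:
  assumes "0 \<le> s" "half_gap p q a = s * t" "p + q = s" "0 \<le> t" "t \<le> 1 / 2"
  shows "block_entropy p q a = s * binary_entropy (1 / 2 + t) + entropy_term s"
proof -
  have "(p + q) / 2 + half_gap p q a = s * (1 / 2 + t)"
    "(p + q) / 2 - half_gap p q a = s * (1 - (1 / 2 + t))"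
    using assms(2,3) by (simp_all add: algebra_simps)
  then show ?thesis
    unfolding block_entropy_def using entropy_term_split[of s "1 / 2 + t"] assms by simp
qed

text \<open>The bound on \<open>a\<close> says that the determinant is nonnegative, which keeps the
  smaller eigenvalue nonnegative.\<close>

lemma half_gap_le:
  assumes "0 \<le> p" "0 \<le> q" "\<bar>a\<bar> \<le> sqrt (p * q)"
  shows "half_gap p q a \<le> (p + q) / 2"
proof -
  have "a\<^sup>2 \<le> p * q"
    using assms by (metis mult_nonneg_nonneg real_sqrt_abs real_sqrt_le_iff)
  then have "((p - q) / 2)\<^sup>2 + a\<^sup>2 \<le> ((p + q) / 2)\<^sup>2"
    by (simp add: power2_eq_square field_simps)
  then show ?thesis
    using assms unfolding half_gap_def by (intro real_le_lsqrt) auto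
qed

lemma half_gap_nonneg: "0 \<le> half_gap p q a"
  by (simp add: half_gap_def)

text \<open>The relative half gap is given through a product because a block may have trace zero, as
  happens for a bit error rate of 0 or 1.\<close>

lemma half_gap_eq_scaled:
  assumes "0 \<le> p" "0 \<le> q" "\<bar>a\<bar> \<le> sqrt (p * q)"
  obtains t where "half_gap p q a = (p + q) * t" "0 \<le> t" "t \<le> 1 / 2"
proof (cases "p + q = 0")
  case True
  then have "half_gap p q a = (p + q) * 0"
    using half_gap_le[OF assms] half_gap_nonneg[of p q a] by simp
  then show ?thesis by (rule that) auto
next
  case False
  then have pos: "0 < p + q" using assms by linarith
  show ?thesis
  proof (rule that[of "half_gap p q a / (p + q)"])
    show "half_gap p q a / (p + q) \<le> 1 / 2"
      using pos half_gap_le[OF assms] by (simp add: field_simps)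
  qed (use pos half_gap_nonneg[of p q a] in auto)
qed

text \<open>Minkowski's inequality in the plane: adding blocks adds their vectors (half diagonal
  difference, off-diagonal entry).\<close>

lemma half_gap_triangle:
  "half_gap (p + p') (q + q') (a + a') \<le> half_gap p q a + half_gap p' q' a'"
proof -
  have "(p + p' - (q + q')) / 2 = (p - q) / 2 + (p' - q') / 2" by (simp add: field_simps)
  then show ?thesis
    unfolding half_gap_def by (simp only: real_sqrt_sum_squares_triangle_ineq)
qed

lemma half_gap_scale: "0 \<le> s \<Longrightarrow> half_gap (s * p) (s * q) (s * a) = s * half_gap p q a"
proof -
  assume s: "0 \<le> s"
  have "((s * p - s * q) / 2)\<^sup>2 + (s * a)\<^sup>2 = s\<^sup>2 * (((p - q) / 2)\<^sup>2 + a\<^sup>2)"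
    by (simp add: power2_eq_square field_simps)
  then show ?thesis using s by (simp add: half_gap_def real_sqrt_mult)
qed

text \<open>With relative half gaps \<open>u\<close> and \<open>v\<close>, the left side is
  \<open>binary_entropy e\<close> plus the average of the binary entropies at
  \<open>1 / 2 + u\<close> and \<open>1 / 2 + v\<close>. The sum of the two blocks has trace one,
  and its half gap is at most the average of \<open>u\<close> and \<open>v\<close>, so
  \<open>binary_entropy_mixture_le\<close> applies.\<close>

lemma block_entropies_le:
  assumes "0 \<le> p" "0 \<le> q" "\<bar>a\<bar> \<le> sqrt (p * q)"
    and "0 \<le> r" "0 \<le> t" "\<bar>b\<bar> \<le> sqrt (r * t)"
    and "p + q = 1 - e" "r + t = e"
  shows "block_entropy p q a + block_entropy r t b \<le>
    binary_entropy e + binary_entropy (1 / 2 + half_gap (p + r) (q + t) (a + b))"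
proof -
  obtain u where u: "half_gap p q a = (p + q) * u" "0 \<le> u" "u \<le> 1 / 2"
    using half_gap_eq_scaled assms by metis
  obtain v where v: "half_gap r t b = (r + t) * v" "0 \<le> v" "v \<le> 1 / 2"
    using half_gap_eq_scaled assms by metis
  define g where "g = half_gap (p + r) (q + t) (a + b)"
  have e: "0 \<le> e" "e \<le> 1" using assms by linarith+
  have g: "g \<le> (1 - e) * u + e * v"
    using half_gap_triangle[of p r q t a b] u v assms by (simp add: g_def)
  have "(1 - e) * u + e * v \<le> (1 - e) * (1 / 2) + e * (1 / 2)"
    using u v e by (intro add_mono mult_left_mono) auto
  then have g': "g \<le> 1 / 2" using g by (simp add: field_simps)
  have "(1 - e) * binary_entropy (1 / 2 + u) + e * binary_entropy (1 / 2 + v) \<le> binary_entropy (1 / 2 + g)"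
  proof (rule binary_entropy_mixture_le)
    have "(1 - e) * (1 / 2 + u) + e * (1 / 2 + v) = 1 / 2 + ((1 - e) * u + e * v)"
      by (simp add: algebra_simps add_divide_distrib[symmetric])
    then show "1 / 2 + g \<le> (1 - e) * (1 / 2 + u) + e * (1 / 2 + v)" using g by simp
  qed (use u v e g' half_gap_nonneg[of "p + r" "q + t" "a + b"] in \<open>auto simp: g_def\<close>)
  moreover have "block_entropy p q a = (1 - e) * binary_entropy (1 / 2 + u) + entropy_term (1 - e)"
    using block_entropy_scaled[of "1 - e" p q a u] e u assms by simp
  moreover have "block_entropy r t b = e * binary_entropy (1 / 2 + v) + entropy_term e"
    using block_entropy_scaled[of e r t b v] e v assms by simp
  ultimately show ?thesis by (simp add: g_def binary_entropy_eq)
qed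

text \<open>At the stated point the blocks are \<open>1 - e\<close> and \<open>e\<close> times one
  matrix with diagonal \<open>x\<close>, \<open>1 - x\<close> and off-diagonal entry
  \<open>s * \<gamma>\<close>, which turns the triangle inequality into an equality. In the
  application \<gamma> is \<open>1 - 2 * ep\<close>.\<close>

lemma coherence_optimum:
  fixes x e \<gamma> :: real
  defines "s \<equiv> sqrt (x * (1 - x))"
  assumes x: "0 \<le> x" "x \<le> 1" and e: "0 \<le> e" "e \<le> 1" and \<gamma>: "\<bar>\<gamma>\<bar> \<le> 1"
    and m: "diag_elem \<sigma> 0 0 = x * (1 - e)" "diag_elem \<sigma> 0 1 = (1 - x) * e"
      "diag_elem \<sigma> 1 0 = x * e" "diag_elem \<sigma> 1 1 = (1 - x) * (1 - e)"
    and ph: "phase_error \<sigma> = 1 / 2 - s * \<gamma>"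
  shows "is_arg_min (coherence_ab \<sigma>) (feasible \<sigma>) ((1 - e) * (s * \<gamma>), e * (s * \<gamma>))" (is "is_arg_min _ _ ?p")
    and "coherence_ab \<sigma> ((1 - e) * (s * \<gamma>), e * (s * \<gamma>)) =
      binary_entropy x - binary_entropy (1 / 2 + half_gap x (1 - x) (s * \<gamma>))"
proof -
  define g where "g = half_gap x (1 - x) (s * \<gamma>)"
  have s0: "0 \<le> s" using x by (simp add: s_def)
  have s\<gamma>: "\<bar>s * \<gamma>\<bar> \<le> s"
    using s0 \<gamma> mult_left_le[of "\<bar>\<gamma>\<bar>" s] by (simp add: abs_mult)
  have g2: "g \<le> 1 / 2" "0 \<le> g"
    using half_gap_le[of x "1 - x" "s * \<gamma>"] x s\<gamma> by (simp_all add: g_def s_def half_gap_nonneg)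
  \<comment> \<open>The bound on \<open>b\<close> occurs with its factors in both orders:
    \<open>feasible\<close> puts 01 first, the second block puts 10 first.\<close>
  have roots: "sqrt (x * (1 - e) * ((1 - x) * (1 - e))) = (1 - e) * s"
    "sqrt ((1 - x) * e * (x * e)) = e * s" "sqrt (x * e * ((1 - x) * e)) = e * s"
    using e by (simp_all add: s_def real_sqrt_mult ac_simps)
  have entropy_diag: "von_neumann_entropy (rho_ab \<sigma> 0 0) = binary_entropy x + binary_entropy e"
    using entropy_term_split[of "1 - e" x] entropy_term_split[of e x] x e
    by (simp add: von_neumann_entropy_rho_ab block_entropy_diag m binary_entropy_eq[of e] algebra_simps)
  have coh: "coherence_ab \<sigma> (a, b) = binary_entropy x + binary_entropy e -
      (block_entropy (x * (1 - e)) ((1 - x) * (1 - e)) a + block_entropy (x * e) ((1 - x) * e) b)" for a b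
    by (simp only: coherence_ab_def prod.case coherence_def diagonal_part_rho_ab entropy_diag
        von_neumann_entropy_rho_ab[of \<sigma> a b] m)
  have block: "block_entropy (x * u) ((1 - x) * u) (u * (s * \<gamma>)) =
      u * binary_entropy (1 / 2 + g) + entropy_term u" if "0 \<le> u" for u
    using that g2 half_gap_scale[of u x "1 - x" "s * \<gamma>"]
    by (intro block_entropy_scaled) (simp_all add: g_def mult.commute algebra_simps)
  show val: "coherence_ab \<sigma> ?p = binary_entropy x - binary_entropy (1 / 2 + half_gap x (1 - x) (s * \<gamma>))"
    using block[of "1 - e"] block[of e] e
    unfolding coh g_def[symmetric] binary_entropy_eq[of e] by (simp add: algebra_simps)
  have feas: "feasible \<sigma> ?p"
  proof -
    have "\<bar>u * (s * \<gamma>)\<bar> \<le> u * s" if "0 \<le> u" for u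
      using mult_left_mono[OF s\<gamma> that] that by (simp add: abs_mult)
    from this[of "1 - e"] this[of e] show ?thesis
      using e by (simp only: feasible_def prod.case m ph roots) (simp add: algebra_simps)
  qed
  have "coherence_ab \<sigma> ?p \<le> coherence_ab \<sigma> (a, b)" if "feasible \<sigma> (a, b)" for a b
  proof -
    have ab: "a + b = s * \<gamma>" "\<bar>a\<bar> \<le> (1 - e) * s" "\<bar>b\<bar> \<le> e * s"
      using that unfolding feasible_def prod.case m ph roots by simp_all
    \<comment> \<open>This bound depends on \<open>a\<close> and \<open>b\<close> only through their
      sum, which feasibility fixes.\<close>
    have "block_entropy (x * (1 - e)) ((1 - x) * (1 - e)) a + block_entropy (x * e) ((1 - x) * e) b \<le>
      binary_entropy e + binary_entropy (1 / 2 +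
        half_gap (x * (1 - e) + x * e) ((1 - x) * (1 - e) + (1 - x) * e) (a + b))"
      using x e ab by (intro block_entropies_le) (simp_all only: roots, simp_all, simp_all add: algebra_simps)
    moreover have "x * (1 - e) + x * e = x" "(1 - x) * (1 - e) + (1 - x) * e = 1 - x"
      by (simp_all add: algebra_simps)
    ultimately show ?thesis
      unfolding val unfolding coh[of a b] by (simp add: ab(1))
  qed
  then show "is_arg_min (coherence_ab \<sigma>) (feasible \<sigma>) ?p"
    using feas by (auto simp: is_arg_min_linorder)
qed

section \<open>Filtered states\<close>

lemma trace_proj_mult: "trace (proj v ** A) = expectation A v"
  unfolding trace_def expectation_def
  by (simp add: matrix_matrix_mult_def ketbra_def matrix_vector_mult_def sum_distrib_left mult_ac)
     (subst sum.swap, simp)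

lemma trace_add_mult: "trace ((A + B) ** C) = trace (A ** C) + trace (B ** (C :: complex^'n^'n))"
  by (simp add: trace_mul_sym[of _ C] matrix_add_ldistrib trace_add)

lemma expectation_ket2: "expectation A (ket2 i j) = A $ (i, j) $ (i, j)"
proof -
  have "cnj (ket2 i j $ p) * (\<Sum>q\<in>UNIV. A $ p $ q * ket2 i j $ q) =
      (if p = (i, j) then A $ (i, j) $ (i, j) else 0)" for p
    by (simp add: ket2_component if_distrib[of "\<lambda>t. _ * t"] cong: if_cong)
  then show ?thesis
    by (simp add: expectation_def matrix_vector_mult_def)
qed

lemma bit_error_eq: "bit_error A = Re (A $ (0, 1) $ (0, 1)) + Re (A $ (1, 0) $ (1, 0))"
  by (simp add: bit_error_def Pi_z_minus_def trace_add_mult trace_proj_mult expectation_ket2)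

section \<open>The two-qubit \<open>X\<close> basis\<close>

abbreviation "ket_pp \<equiv> tensor_ket ket_plus ket_plus"
abbreviation "ket_pm \<equiv> tensor_ket ket_plus ket_minus"
abbreviation "ket_mp \<equiv> tensor_ket ket_minus ket_plus"
abbreviation "ket_mm \<equiv> tensor_ket ket_minus ket_minus"

lemma phase_error_eq: "phase_error A = Re (expectation A ket_pm) + Re (expectation A ket_mp)"
  by (simp add: phase_error_def Pi_x_minus_def trace_add_mult trace_proj_mult)

lemma ket_pm_components:
  "ket_plus $ i = complex_of_real (1 / sqrt 2)"
  "ket_minus $ i = complex_of_real (if i = 0 then 1 / sqrt 2 else - (1 / sqrt 2))"
  \<comment> \<open>\<open>exhaust_2\<close> yields the values 1 and 2, and in the type
    \<open>2\<close> the latter is 0.\<close>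
  using exhaust_2[of i] by (auto simp: ket_plus_def ket_minus_def ket_component scaleR_conv_of_real[of _ "_ :: complex"])

lemma tensor_x_components:
  "ket_pp $ p = 1 / 2"
  "ket_pm $ p = (if snd p = 0 then 1 / 2 else - 1 / 2)"
  "ket_mp $ p = (if fst p = 0 then 1 / 2 else - 1 / 2)"
  "ket_mm $ p = (if fst p = snd p then 1 / 2 else - 1 / 2)"
proof -
  have h: "complex_of_real (1 / sqrt 2) * complex_of_real (1 / sqrt 2) = 1 / 2"
    unfolding of_real_mult[symmetric] by simp
  have "fst p = 0 \<or> fst p = 1" "snd p = 0 \<or> snd p = 1"
    using UNIV_two by auto
  then show "ket_pp $ p = 1 / 2"
    "ket_pm $ p = (if snd p = 0 then 1 / 2 else - 1 / 2)"
    "ket_mp $ p = (if fst p = 0 then 1 / 2 else - 1 / 2)"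
    "ket_mm $ p = (if fst p = snd p then 1 / 2 else - 1 / 2)"
    using h by (auto simp: tensor_ket_def ket_pm_components simp del: of_real_divide)
qed

lemma trace_eq_x_basis:
  "trace A = expectation A ket_pp + expectation A ket_pm + expectation A ket_mp + expectation A ket_mm"
  unfolding expectation_def trace_def
  by (simp add: sum_two_qubit tensor_x_components matrix_vector_mult_def algebra_simps)

text \<open>The projection onto unequal \<open>X\<close> outcomes is half of the identity minus X
  tensor X. The latter flips both qubits, so its trace against \<open>A\<close> is the sum of the
  four antidiagonal entries.\<close>

lemma expectation_pm_mp:
  "expectation A ket_pm + expectation A ket_mp =
     (trace A - (A $ (0, 0) $ (1, 1) + A $ (0, 1) $ (1, 0) + A $ (1, 0) $ (0, 1) + A $ (1, 1) $ (0, 0))) / 2"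
  unfolding expectation_def trace_def
  by (simp add: sum_two_qubit tensor_x_components matrix_vector_mult_def field_simps)

lemma expectation_scaleR_ket: "expectation A (c *\<^sub>R v) = of_real (c\<^sup>2) * expectation A v"
  unfolding expectation_def sum_distrib_left
  by (rule sum.cong) (simp_all add: matrix_vector_mult_def scaleR_conv_of_real[of _ "_ :: complex"]
      sum_distrib_left power2_eq_square mult_ac)

lemma expectation_scaleR_op: "expectation (c *\<^sub>R A) v = of_real c * expectation A v"
  unfolding expectation_def sum_distrib_left
  by (rule sum.cong) (simp_all add: matrix_vector_mult_def scaleR_conv_of_real[of _ "_ :: complex"]
      sum_distrib_left mult_ac)

section \<open>Filtering Bob's qubit in the \<open>X\<close> basis\<close>

lemma expectation_sandwich:
  assumes "dagger K = K"
  shows "expectation (K ** A ** K) v = expectation A (K *v v)"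
proof -
  have adj: "(\<Sum>i\<in>UNIV. cnj (v $ i) * (K *v w) $ i) = (\<Sum>i\<in>UNIV. cnj ((K *v v) $ i) * w $ i)" for w
  proof -
    have K: "cnj (K $ i $ j) = K $ j $ i" for i j
      using arg_cong[OF assms, of "\<lambda>M. M $ j $ i"] by (simp add: dagger_def)
    have "(\<Sum>i\<in>UNIV. cnj (v $ i) * (K *v w) $ i) =
        (\<Sum>i\<in>UNIV. \<Sum>j\<in>UNIV. cnj (v $ i) * (K $ i $ j * w $ j))"
      by (simp add: matrix_vector_mult_def sum_distrib_left)
    also have "\<dots> = (\<Sum>j\<in>UNIV. \<Sum>i\<in>UNIV. cnj (v $ i) * (K $ i $ j * w $ j))"
      by (rule sum.swap)
    also have "\<dots> = (\<Sum>j\<in>UNIV. cnj ((K *v v) $ j) * w $ j)"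
      by (simp add: matrix_vector_mult_def sum_distrib_left K mult_ac)
    finally show ?thesis .
  qed
  have "(K ** A ** K) *v v = K *v (A *v (K *v v))"
    by (simp add: matrix_vector_mul_assoc matrix_mul_assoc)
  then show ?thesis
    unfolding expectation_def using adj by metis
qed

lemma tensor_op_mult_ket: "tensor_op (mat 1) F *v tensor_ket u v = tensor_ket u (F *v v)"
  unfolding vec_eq_iff
proof
  fix p
  have "(tensor_op (mat 1) F *v tensor_ket u v) $ p =
      (\<Sum>(k, l)\<in>UNIV \<times> UNIV. (if fst p = k then 1 else 0) * F $ snd p $ l * (u $ k * v $ l))"
    by (simp add: matrix_vector_mult_def tensor_op_def tensor_ket_def mat_def case_prod_beta)
  also have "\<dots> = (\<Sum>k\<in>UNIV. if fst p = k then \<Sum>l\<in>UNIV. F $ snd p $ l * (u $ k * v $ l) else 0)"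
    unfolding sum.cartesian_product[symmetric] by (rule sum.cong) auto
  also have "\<dots> = tensor_ket u (F *v v) $ p"
    by (simp add: tensor_ket_def matrix_vector_mult_def sum_distrib_left mult_ac)
  finally show "(tensor_op (mat 1) F *v tensor_ket u v) $ p = tensor_ket u (F *v v) $ p" .
qed

lemma tensor_ket_scaleR: "tensor_ket u (c *\<^sub>R v) = c *\<^sub>R tensor_ket u v"
  by (simp add: vec_eq_iff tensor_ket_def)

lemma dagger_tensor_F_x: "dagger (tensor_op (mat 1) (F_x \<eta>0 \<eta>1)) = tensor_op (mat 1) (F_x \<eta>0 \<eta>1)"
  by (auto simp: vec_eq_iff dagger_def tensor_op_def mat_def F_x_def ketbra_def ket_pm_components mult_ac)

lemma F_x_mult_ket:
  "F_x \<eta>0 \<eta>1 *v ket_plus = sqrt \<eta>0 *\<^sub>R ket_plus" "F_x \<eta>0 \<eta>1 *v ket_minus = sqrt \<eta>1 *\<^sub>R ket_minus"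
proof -
  have h: "complex_of_real (sqrt 2) * complex_of_real (sqrt 2) = 2"
    unfolding of_real_mult[symmetric] by simp
  have two: "(\<Sum>i\<in>UNIV. g i) = g 0 + g (1 :: 2)" for g :: "2 \<Rightarrow> complex"
    by (simp add: UNIV_two)
  show "F_x \<eta>0 \<eta>1 *v ket_plus = sqrt \<eta>0 *\<^sub>R ket_plus" "F_x \<eta>0 \<eta>1 *v ket_minus = sqrt \<eta>1 *\<^sub>R ket_minus"
    using h by (auto simp: vec_eq_iff matrix_vector_mult_def two F_x_def ketbra_def ket_pm_components
        scaleR_conv_of_real[of _ "_ :: complex"] field_simps)
qed

text \<open>Bob's \<open>X\<close> basis consists of eigenvectors of the filter, with eigenvalues
  \<open>sqrt \<eta>0\<close> and \<open>sqrt \<eta>1\<close>, and each eigenvalue enters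
  twice.\<close>

lemma expectation_filter_x:
  fixes \<rho> :: two_qubit_op
  assumes "0 \<le> \<eta>0" "0 \<le> \<eta>1"
  defines "\<sigma> \<equiv> tensor_op (mat 1) (F_x \<eta>0 \<eta>1) ** \<rho> ** tensor_op (mat 1) (F_x \<eta>0 \<eta>1)"
  shows "expectation \<sigma> (tensor_ket u ket_plus) = of_real \<eta>0 * expectation \<rho> (tensor_ket u ket_plus)"
    and "expectation \<sigma> (tensor_ket u ket_minus) = of_real \<eta>1 * expectation \<rho> (tensor_ket u ket_minus)"
  using assms(1,2) unfolding \<sigma>_def expectation_sandwich[OF dagger_tensor_F_x]
  by (simp_all add: tensor_op_mult_ket F_x_mult_ket tensor_ket_scaleR expectation_scaleR_ket)

text \<open>By symmetry the two error outcomes are equally likely, and so are the two agreeing ones.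
  The filter therefore multiplies both the error weight and the trace by
  \<open>(\<eta>0 + \<eta>1) / 2\<close>, and their ratio is unchanged.\<close>

lemma phase_error_rho_X:
  assumes \<eta>: "0 \<le> \<eta>0" "0 \<le> \<eta>1" "\<eta>0 + \<eta>1 > 0" and \<rho>: "density_matrix \<rho>" "symmetric_ZX \<rho>"
  shows "phase_error (rho_X \<eta>0 \<eta>1 \<rho>) = phase_error \<rho>"
proof -
  define \<sigma> where "\<sigma> = tensor_op (mat 1) (F_x \<eta>0 \<eta>1) ** \<rho> ** tensor_op (mat 1) (F_x \<eta>0 \<eta>1)"
  note ex = expectation_filter_x[OF \<eta>(1,2), of \<rho>, folded \<sigma>_def]
  define P Q where "P = Re (expectation \<rho> ket_pp)" and "Q = Re (expectation \<rho> ket_pm)"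
  have eqs: "Re (expectation \<rho> ket_mm) = P" "Re (expectation \<rho> ket_mp) = Q"
    using \<rho>(2) by (simp_all add: symmetric_ZX_def P_def Q_def)
  have "Re (trace \<rho>) = 1" using \<rho>(1) by (simp add: density_matrix_def)
  then have PQ: "2 * (P + Q) = 1"
    by (simp add: trace_eq_x_basis eqs P_def[symmetric] Q_def[symmetric])
  have "Re (trace \<sigma>) = (\<eta>0 + \<eta>1) * (P + Q)"
    by (simp add: trace_eq_x_basis ex eqs P_def[symmetric] Q_def[symmetric] algebra_simps)
  then have tr: "Re (trace \<sigma>) = (\<eta>0 + \<eta>1) / 2" using PQ by simp
  have "rho_X \<eta>0 \<eta>1 \<rho> = (2 / (\<eta>0 + \<eta>1)) *\<^sub>R \<sigma>"
    by (simp add: rho_X_def filter_Bob_def Let_def \<sigma>_def[symmetric] tr)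
  moreover have "Re (expectation (c *\<^sub>R \<sigma>) v) = c * Re (expectation \<sigma> v)" for c v
    unfolding expectation_scaleR_op by simp
  ultimately have "phase_error (rho_X \<eta>0 \<eta>1 \<rho>) =
      2 / (\<eta>0 + \<eta>1) * Re (expectation \<sigma> ket_pm) + 2 / (\<eta>0 + \<eta>1) * Re (expectation \<sigma> ket_mp)"
    by (simp only: phase_error_eq)
  also have "\<dots> = 2 / (\<eta>0 + \<eta>1) * (\<eta>1 * Q + \<eta>0 * Q)"
    by (simp add: ex eqs Q_def[symmetric] distrib_left)
  also have "\<dots> = 2 * Q" using \<eta>(3) by (simp add: field_simps)
  finally show ?thesis by (simp add: phase_error_eq eqs Q_def[symmetric])
qed

section \<open>Filtering Bob's qubit in the \<open>Z\<close> basis\<close>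

lemma tensor_F_z:
  "tensor_op (mat 1) (F_z \<eta>0 \<eta>1) = diag_matrix (\<chi> p. if snd p = 0 then sqrt \<eta>0 else sqrt \<eta>1)"
  unfolding vec_eq_iff all_two_qubit
  by (simp add: tensor_op_def mat_def F_z_def diag_matrix_def ketbra_def ket_component
      scaleR_conv_of_real[of _ "_ :: complex"])

text \<open>A diagonal filter rescales each entry. The constant in front is the inverse of the
  filtered trace, which the \<open>Z\<close> symmetry fixes at
  \<open>(\<eta>0 + \<eta>1) / 2\<close>.\<close>

lemma Re_rho_Z_component:
  assumes \<eta>: "0 \<le> \<eta>0" "0 \<le> \<eta>1" and \<rho>: "density_matrix \<rho>" "symmetric_ZX \<rho>"
  defines "w \<equiv> \<lambda>p :: 2 \<times> 2. if snd p = 0 then sqrt \<eta>0 else sqrt \<eta>1"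
  shows "Re (rho_Z \<eta>0 \<eta>1 \<rho> $ p $ q) = 2 / (\<eta>0 + \<eta>1) * (w p * w q * Re (\<rho> $ p $ q))"
proof -
  define \<sigma> where "\<sigma> = tensor_op (mat 1) (F_z \<eta>0 \<eta>1) ** \<rho> ** tensor_op (mat 1) (F_z \<eta>0 \<eta>1)"
  have "\<sigma> $ p $ q = of_real (w p * w q) * \<rho> $ p $ q" for p q
    unfolding \<sigma>_def tensor_F_z diag_matrix_mult_left diag_matrix_mult_right w_def by simp
  then have \<sigma>: "Re (\<sigma> $ p $ q) = w p * w q * Re (\<rho> $ p $ q)" for p q
    by (metis Re_complex_of_real Im_complex_of_real mult_zero_left diff_zero times_complex.sel(1))
  define P Q where "P = Re (\<rho> $ (0, 0) $ (0, 0))" and "Q = Re (\<rho> $ (0, 1) $ (0, 1))"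
  have eqs: "Re (\<rho> $ (1, 1) $ (1, 1)) = P" "Re (\<rho> $ (1, 0) $ (1, 0)) = Q"
    using \<rho>(2) by (simp_all add: symmetric_ZX_def expectation_ket2 P_def Q_def)
  have "Re (trace \<rho>) = 1" using \<rho>(1) by (simp add: density_matrix_def)
  then have PQ: "2 * (P + Q) = 1"
    by (simp add: trace_def sum_two_qubit eqs P_def[symmetric] Q_def[symmetric])
  have "Re (trace \<sigma>) = \<eta>0 * P + \<eta>1 * Q + \<eta>0 * Q + \<eta>1 * P"
    using \<eta> by (simp add: trace_def sum_two_qubit \<sigma> w_def eqs P_def[symmetric] Q_def[symmetric])
  also have "\<dots> = (\<eta>0 + \<eta>1) * (P + Q)" by (simp add: algebra_simps)
  finally have tr: "Re (trace \<sigma>) = (\<eta>0 + \<eta>1) / 2" using PQ by simp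
  show ?thesis
    by (simp add: rho_Z_def filter_Bob_def Let_def \<sigma>_def[symmetric] tr \<sigma>)
qed

text \<open>A \<open>LEAST\<close> over the reals is informative only if the minimum is attained,
  hence the explicit minimiser.\<close>

lemma key_rate_eq:
  assumes "is_arg_min (coherence_ab \<sigma>) (feasible \<sigma>) p"
  shows "key_rate \<sigma> = coherence_ab \<sigma> p - binary_entropy (bit_error \<sigma>)"
proof -
  have "(LEAST c. \<exists>p. feasible \<sigma> p \<and> c = coherence_ab \<sigma> p) = coherence_ab \<sigma> p"
    using assms by (intro Least_equality) (auto simp only: is_arg_min_linorder)
  then show ?thesis by (simp add: key_rate_def)
qed

text \<open>The first conjunct certifies that the \<open>LEAST\<close> inside
  \<open>key_rate\<close> is an attained minimum.\<close>

theorem mainTheorem8: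
  fixes \<eta>0 \<eta>1 :: real and \<rho> :: two_qubit_op
  assumes "0 \<le> \<eta>0" "\<eta>0 \<le> 1" "0 \<le> \<eta>1" "\<eta>1 \<le> 1" "\<eta>0 + \<eta>1 > 0"
    and "density_matrix \<rho>"
    and "symmetric_ZX \<rho>"
  shows "let \<rho>Z = rho_Z \<eta>0 \<eta>1 \<rho>;
             \<rho>X = rho_X \<eta>0 \<eta>1 \<rho>;
             e_b = bit_error \<rho>Z;
             e_p = phase_error \<rho>X;
             x = \<eta>0 / (\<eta>0 + \<eta>1)
         in (\<exists>p. is_arg_min (coherence_ab \<rho>Z) (feasible \<rho>Z) p) \<and>
            key_rate \<rho>Z =
              binary_entropy x - binary_entropy (f_mismatch x e_p) - binary_entropy e_b"
proof -
  define \<rho>Z where "\<rho>Z = rho_Z \<eta>0 \<eta>1 \<rho>"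
  define x where "x = \<eta>0 / (\<eta>0 + \<eta>1)"
  \<comment> \<open>\<open>e\<close> and \<open>ep\<close> are the error rates of the unfiltered
    state; they turn out to equal those observed after the \<open>Z\<close> and the \<open>X\<close>
    filter respectively.\<close>
  define e where "e = bit_error \<rho>"
  define ep where "ep = phase_error \<rho>"
  note comp = Re_rho_Z_component[OF assms(1,3,6,7), folded \<rho>Z_def]
  have x': "1 - x = \<eta>1 / (\<eta>0 + \<eta>1)" using assms(5) by (simp add: x_def field_simps)
  have x: "0 \<le> x" "0 \<le> 1 - x" unfolding x' using assms by (simp_all add: x_def)
  have pos: "0 \<le> Re (expectation \<rho> v)" for v
    using assms(6) by (simp add: density_matrix_def)
  have tr: "Re (trace \<rho>) = 1" using assms(6) by (simp add: density_matrix_def)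
  have ep: "0 \<le> ep" "ep \<le> 1"
    using pos[of ket_pp] pos[of ket_pm] pos[of ket_mp] pos[of ket_mm] tr
    by (simp_all add: ep_def phase_error_eq trace_eq_x_basis)
  have eqs: "Re (\<rho> $ (1, 1) $ (1, 1)) = Re (\<rho> $ (0, 0) $ (0, 0))" "Re (\<rho> $ (0, 1) $ (0, 1)) = Re (\<rho> $ (1, 0) $ (1, 0))"
    using assms(7) by (simp_all add: symmetric_ZX_def expectation_ket2)
  have diag: "Re (\<rho> $ (0, 0) $ (0, 0)) = (1 - e) / 2" "Re (\<rho> $ (1, 1) $ (1, 1)) = (1 - e) / 2"
    "Re (\<rho> $ (0, 1) $ (0, 1)) = e / 2" "Re (\<rho> $ (1, 0) $ (1, 0)) = e / 2"
    using tr eqs by (simp_all add: e_def bit_error_eq trace_def sum_two_qubit)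
  have e: "0 \<le> e" "e \<le> 1"
    using diag pos[of "ket2 0 0"] pos[of "ket2 0 1"] by (simp_all add: expectation_ket2)
  have m: "diag_elem \<rho>Z 0 0 = x * (1 - e)" "diag_elem \<rho>Z 0 1 = (1 - x) * e"
    "diag_elem \<rho>Z 1 0 = x * e" "diag_elem \<rho>Z 1 1 = (1 - x) * (1 - e)"
    unfolding x' using assms(1,3) diag
    by (simp_all add: diag_elem_def comp x_def)
  have bit: "bit_error \<rho>Z = e"
    using m by (simp add: bit_error_eq diag_elem_def algebra_simps)
  have trZ: "Re (trace \<rho>Z) = 1"
    using m by (simp add: trace_def sum_two_qubit diag_elem_def algebra_simps)
  define s where "s = sqrt (x * (1 - x))"
  \<comment> \<open>Each of these four entries links a Bob bit 0 with a Bob bit 1. The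
    \<open>Z\<close> filter thus multiplies all of them by the same
    \<open>sqrt \<eta>0 * sqrt \<eta>1\<close>, which the normalisation turns into
    \<open>2 * s\<close>.\<close>
  define R where "R = Re (\<rho> $ (0, 0) $ (1, 1) + \<rho> $ (0, 1) $ (1, 0) + \<rho> $ (1, 0) $ (0, 1) + \<rho> $ (1, 1) $ (0, 0))"
  have s: "s = sqrt \<eta>0 * sqrt \<eta>1 / (\<eta>0 + \<eta>1)"
    unfolding s_def x' unfolding x_def using assms(5) by (simp add: real_sqrt_divide real_sqrt_mult)
  have half: "phase_error A = (Re (trace A) - Re (A $ (0, 0) $ (1, 1) + A $ (0, 1) $ (1, 0) +
      A $ (1, 0) $ (0, 1) + A $ (1, 1) $ (0, 0))) / 2" for A
    using arg_cong[OF expectation_pm_mp[of A], of Re] by (simp add: phase_error_eq)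
  have R: "R = 1 - 2 * ep"
    using half[of \<rho>] tr by (simp add: ep_def R_def)
  have "phase_error \<rho>Z = (1 - 2 * s * R) / 2"
    unfolding half trZ by (simp add: comp s R_def) (simp add: divide_inverse algebra_simps)
  then have ph: "phase_error \<rho>Z = 1 / 2 - s * (1 - 2 * ep)"
    by (simp add: R field_simps)
  have "\<bar>1 - 2 * ep\<bar> \<le> 1" using ep by auto
  note opt = coherence_optimum[OF x(1) _ e this m ph[unfolded s_def]]
  have f: "f_mismatch x ep = 1 / 2 + half_gap x (1 - x) (s * (1 - 2 * ep))"
  proof -
    have "((x - (1 - x)) / 2)\<^sup>2 = (1 / 2 - x)\<^sup>2" "(s * (1 - 2 * ep))\<^sup>2 = x * (1 - x) * (1 - 2 * ep)\<^sup>2"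
      using x by (simp_all add: s_def power_mult_distrib) (simp add: power2_eq_square field_simps)
    then show ?thesis by (simp only: f_mismatch_def half_gap_def)
  qed
  have min: "is_arg_min (coherence_ab \<rho>Z) (feasible \<rho>Z) ((1 - e) * (s * (1 - 2 * ep)), e * (s * (1 - 2 * ep)))"
    using opt(1) x by (simp add: s_def)
  moreover have "key_rate \<rho>Z = binary_entropy x - binary_entropy (f_mismatch x ep) - binary_entropy e"
    using key_rate_eq[OF min] opt(2) x by (simp add: bit f s_def)
  ultimately show ?thesis
    using phase_error_rho_X[OF assms(1,3,5,6,7)] bit
    unfolding Let_def \<rho>Z_def x_def ep_def by metis
qed

end
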